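(* Let $\{Z(t)\}$ be the heat diffusion process on the complete graph $K_N$ with $N$ nodes, and let $\mathbf{T}(t)=e^{-t\mathbf{L}}$ be its transition matrix over time $t\ge 0$, where $\mathbf{L}$ is the combinatorial Laplacian of $K_N$. Then $$T_{i,j}(t)=\begin{cases}\dfrac1N+\dfrac{N-1}{N}e^{-Nt} & \text{if } i=j,\\[2mm] \dfrac1N-\dfrac1N e^{-Nt} & \text{if } i\ne j.\end{cases}$$
   Context: The combinatorial Laplacian $\mathbf{L}$ of a graph with nodes $v_1,\dots,v_N$ has entries $L_{i,i}=d_i$ (the degree of node $i$), $L_{i,j}=-1$ if $i\neq j$ and $v_i,v_j$ are joined by an edge, and $L_{i,j}=0$ otherwise. Heat diffusion is the continuous-time homogeneous Markov chain on the nodes whose probability vector satisfies $\frac{d}{dt}\mathbf{p}^{\intercal}(t)=-\mathbf{p}^{\intercal}(t)\mathbf{L}$ (diffusion rate equal to 1), so its transition matrix over a time $t$ is $\mathbf{T}(t)=e^{-t\mathbf{L}}$. *)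

theory Defs
  imports "HOL-Analysis.Analysis" "HOL-Probability.Probability"
begin

(* A graph whose nodes are the elements of the finite type 'n is given by its adjacency
   relation; a simple undirected graph has a symmetric, irreflexive one. *)

definition complete_adj :: "'n \<Rightarrow> 'n \<Rightarrow> bool" where
  "complete_adj u v \<longleftrightarrow> u \<noteq> v"

definition node_degree :: "('n::finite \<Rightarrow> 'n \<Rightarrow> bool) \<Rightarrow> 'n \<Rightarrow> nat" where
  "node_degree E u = card {v. E u v}"

definition laplacian :: "('n::finite \<Rightarrow> 'n \<Rightarrow> bool) \<Rightarrow> real^'n^'n" where
  "laplacian E = (\<chi> i j. if i = j then real (node_degree E i) else if E i j then -1 else 0)"

(* The product of the type class of real^'n^'n is componentwise, so the library functions
   power and exp on that type are not the matrix ones. *)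

primrec mat_power :: "real^'n^'n \<Rightarrow> nat \<Rightarrow> real^('n::finite)^'n" where
  "mat_power A 0 = mat 1"
| "mat_power A (Suc k) = A ** mat_power A k"

definition mat_exp :: "real^'n^'n \<Rightarrow> real^('n::finite)^'n" where
  "mat_exp A = (\<Sum>k. (1 / fact k) *\<^sub>R mat_power A k)"

(* A process Z on the nodes is considered under a family of laws, P x being the law of the
   process started at the node x.  Only the times t \<ge> 0 are meaningful. *)

definition transition_matrix ::
    "('n::finite \<Rightarrow> 'w measure) \<Rightarrow> (real \<Rightarrow> 'w \<Rightarrow> 'n) \<Rightarrow> real \<Rightarrow> real^'n^'n" where
  "transition_matrix P Z t = (\<chi> x y. \<P>(\<omega> in P x. Z t \<omega> = y))"

(* In the Markov property F is a finite set of times before s, and f prescribes the states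
   visited at these times. *)

definition homogeneous_markov_chain ::
    "('n::finite \<Rightarrow> 'w measure) \<Rightarrow> (real \<Rightarrow> 'w \<Rightarrow> 'n) \<Rightarrow> bool" where
  "homogeneous_markov_chain P Z \<longleftrightarrow>
     (\<forall>x. prob_space (P x)) \<and>
     (\<forall>x. \<forall>t\<ge>0. Z t \<in> P x \<rightarrow>\<^sub>M count_space UNIV) \<and>
     (\<forall>x. AE \<omega> in P x. Z 0 \<omega> = x) \<and>
     (\<forall>x y z f F s t. 0 \<le> s \<longrightarrow> 0 \<le> t \<longrightarrow> finite F \<longrightarrow> F \<subseteq> {0..<s} \<longrightarrow>
        \<P>(\<omega> in P x. (\<forall>u\<in>F. Z u \<omega> = f u) \<and> Z s \<omega> = y) > 0 \<longrightarrow>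
        \<P>(\<omega> in P x. Z (s + t) \<omega> = z \<bar> (\<forall>u\<in>F. Z u \<omega> = f u) \<and> Z s \<omega> = y)
          = transition_matrix P Z t $ y $ z)"

(* The probability vector at time t under P x is row x of the transition matrix.  The
   equation for an arbitrary initial distribution follows from these by linearity. *)

definition heat_diffusion ::
    "('n::finite \<Rightarrow> 'n \<Rightarrow> bool) \<Rightarrow> ('n \<Rightarrow> 'w measure) \<Rightarrow> (real \<Rightarrow> 'w \<Rightarrow> 'n) \<Rightarrow> bool" where
  "heat_diffusion E P Z \<longleftrightarrow>
     homogeneous_markov_chain P Z \<and>
     (\<forall>x. \<forall>t\<ge>0. ((\<lambda>t. transition_matrix P Z t $ x) has_vector_derivative
          - (transition_matrix P Z t $ x v* laplacian E)) (at t within {0..}))"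

end

theory Submission
  imports Defs
begin

text \<open>
  The Laplacian of the complete graph on \<open>N\<close> nodes is \<open>N\<close> times a projection: if \<open>U\<close> denotes
  the matrix all of whose entries are \<open>1 / N\<close>, then \<open>U\<close> is idempotent and \<open>L = N (1 - U)\<close>.
  For an idempotent matrix \<open>Q\<close> every positive power of \<open>c Q\<close> is a multiple of \<open>Q\<close>, so the
  exponential series collapses to the scalar one, \<open>exp (c Q) = (1 - Q) + e\<^sup>c Q\<close>
  (lemma \<open>mat_exp_scaleR_idempotent\<close>). With \<open>Q = 1 - U\<close> and \<open>c = - N t\<close> this gives
  \<open>exp (- t L) = U + e\<^bsup>- N t\<^esup> (1 - U)\<close>, whose entries are the ones asserted.

  That the transition matrix of the process is this exponential is uniqueness for the linear
  equation \<open>p' = c p Q\<close>. The projection decouples it: \<open>p (1 - Q)\<close> is constant, and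
  \<open>p Q\<close> satisfies the scalar equation \<open>q' = c q\<close>
  (lemma \<open>idempotent_linear_ode_unique\<close>). A row of the transition matrix solves the equation
  with \<open>c = - N\<close> and starts at a unit vector because the chain starts at the given node
  almost surely.
\<close>

section \<open>Matrix algebra\<close>

lemma matrix_diff_ldistrib: "A ** (B - C) = A ** B - A ** (C :: 'a::ring_1^'p^'n::finite)"
  by (simp add: matrix_matrix_mult_def vec_eq_iff right_diff_distrib sum_subtractf)

lemma matrix_diff_rdistrib: "(A - B) ** C = A ** C - B ** (C :: 'a::ring_1^'p^'n::finite)"
  by (simp add: matrix_matrix_mult_def vec_eq_iff left_diff_distrib sum_subtractf)

lemma idempotent_complement:
  fixes A :: "'a::ring_1^'n::finite^'n"
  assumes "A ** A = A"
  shows "(mat 1 - A) ** (mat 1 - A) = mat 1 - A"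
  by (simp add: matrix_diff_ldistrib matrix_diff_rdistrib assms)

section \<open>Exponentials of multiples of a projection\<close>

text \<open>
  The summand for \<open>k = 0\<close> absorbs the defect of \<open>Q\<close> from the identity, so that one formula
  covers all exponents, also for \<open>c = 0\<close>.
\<close>

lemma mat_power_scaleR_idempotent:
  fixes Q :: "real^'n::finite^'n"
  assumes "Q ** Q = Q"
  shows "mat_power (c *\<^sub>R Q) k = (if k = 0 then mat 1 - Q else 0) + c ^ k *\<^sub>R Q"
proof (induction k)
  case 0
  then show ?case by simp
next
  case (Suc k)
  have "Q ** mat_power (c *\<^sub>R Q) k = c ^ k *\<^sub>R Q"
    by (simp add: Suc.IH matrix_add_ldistrib matrix_diff_ldistrib matrix_scalar_ac
        scalar_matrix_assoc[symmetric] assms)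
  then show ?case
    by (simp add: scalar_matrix_assoc[symmetric])
qed

lemma mat_exp_scaleR_idempotent:
  fixes Q :: "real^'n::finite^'n"
  assumes "Q ** Q = Q"
  shows "mat_exp (c *\<^sub>R Q) = (mat 1 - Q) + exp c *\<^sub>R Q"
proof -
  have "(\<lambda>k. (c ^ k /\<^sub>R fact k) *\<^sub>R Q) sums (exp c *\<^sub>R Q)"
    by (intro bounded_linear.sums[OF bounded_linear_scaleR_left] exp_converges)
  moreover have "(\<lambda>k. if k = 0 then mat 1 - Q else 0) sums (mat 1 - Q)"
    using sums_single[of 0 "\<lambda>_. mat 1 - Q"] by simp
  ultimately have "(\<lambda>k. (if k = 0 then mat 1 - Q else 0) + (c ^ k /\<^sub>R fact k) *\<^sub>R Q)
      sums ((mat 1 - Q) + exp c *\<^sub>R Q)"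
    by (intro sums_add)
  moreover have "(1 / fact k) *\<^sub>R mat_power (c *\<^sub>R Q) k
      = (if k = 0 then mat 1 - Q else 0) + (c ^ k /\<^sub>R fact k) *\<^sub>R Q" for k
    by (simp add: mat_power_scaleR_idempotent[OF assms] scaleR_add_right divide_inverse)
  ultimately show ?thesis
    unfolding mat_exp_def by (simp add: sums_unique[symmetric])
qed

section \<open>Linear equations driven by a projection\<close>

lemma has_vector_derivative_vector_matrix_mult:
  fixes B :: "real^'n::finite^'m::finite"
  assumes "(p has_vector_derivative d) F"
  shows "((\<lambda>s. p s v* B) has_vector_derivative d v* B) F"
  using bounded_linear.has_vector_derivative
      [OF matrix_vector_mul_bounded_linear[of "transpose B"] assms]
  by simp

lemma constant_on_nonneg:
  fixes f :: "real \<Rightarrow> 'a::real_normed_vector"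
  assumes "\<And>s. s \<ge> 0 \<Longrightarrow> (f has_vector_derivative 0) (at s within {0..})" and "t \<ge> 0"
  shows "f t = f 0"
proof -
  have "\<exists>a. \<forall>x\<in>{0..}. f x = a"
    using assms(1) by (intro has_derivative_zero_constant)
      (auto simp: has_vector_derivative_def)
  then show ?thesis using assms(2) by auto
qed

text \<open>
  Both components of the solution have an invariant: \<open>p (1 - Q)\<close> itself, and
  \<open>e\<^bsup>- c s\<^esup> p Q\<close>, where the integrating factor cancels the growth.
\<close>

lemma idempotent_linear_ode_unique:
  fixes Q :: "real^'n::finite^'n" and p :: "real \<Rightarrow> real^'n"
  assumes Q: "Q ** Q = Q"
    and ode: "\<And>s. s \<ge> 0 \<Longrightarrow>
      (p has_vector_derivative c *\<^sub>R (p s v* Q)) (at s within {0..})"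
    and t: "t \<ge> 0"
  shows "p t = p 0 v* mat_exp ((c * t) *\<^sub>R Q)"
proof -
  have [simp]: "(y v* Q) v* Q = y v* Q" for y
    by (simp add: vector_matrix_mul_assoc Q)
  have proj_deriv:
    "((\<lambda>s. p s v* Q) has_vector_derivative c *\<^sub>R (p s v* Q)) (at s within {0..})"
    if "s \<ge> 0" for s
    using has_vector_derivative_vector_matrix_mult[OF ode[OF that], of Q]
    by (simp add: scaleR_vector_matrix_assoc)
  have kernel: "p t - p t v* Q = p 0 - p 0 v* Q"
  proof (rule constant_on_nonneg[OF _ t])
    fix s :: real assume "s \<ge> 0"
    then show "((\<lambda>s. p s - p s v* Q) has_vector_derivative 0) (at s within {0..})"
      using has_vector_derivative_diff[OF ode proj_deriv] by simp
  qed
  have "exp (- c * t) *\<^sub>R (p t v* Q) = exp (- c * 0) *\<^sub>R (p 0 v* Q)"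
  proof (rule constant_on_nonneg[OF _ t])
    fix s :: real assume "s \<ge> 0"
    have "((\<lambda>s. exp (- c * s)) has_real_derivative - c * exp (- c * s)) (at s within {0..})"
      by (auto intro!: derivative_eq_intros)
    from has_vector_derivative_scaleR[OF this proj_deriv[OF \<open>s \<ge> 0\<close>]]
    show "((\<lambda>s. exp (- c * s) *\<^sub>R (p s v* Q)) has_vector_derivative 0) (at s within {0..})"
      by (simp add: mult.commute)
  qed
  then have "exp (c * t) *\<^sub>R exp (- c * t) *\<^sub>R (p t v* Q) = exp (c * t) *\<^sub>R (p 0 v* Q)"
    by simp
  then have range: "p t v* Q = exp (c * t) *\<^sub>R (p 0 v* Q)"
    by (simp add: exp_minus)
  have "p t = (p 0 - p 0 v* Q) + exp (c * t) *\<^sub>R (p 0 v* Q)"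
    using kernel range by (simp add: algebra_simps)
  also have "\<dots> = p 0 v* mat_exp ((c * t) *\<^sub>R Q)"
    by (simp add: mat_exp_scaleR_idempotent[OF Q] vector_matrix_left_distrib
        vector_matrix_mult_add_rdistrib vector_matrix_mult_diff_rdistrib
        vector_scaleR_matrix_ac)
  finally show ?thesis .
qed

section \<open>The complete graph\<close>

definition averaging_matrix :: "real^'n::finite^'n" where
  "averaging_matrix = (\<chi> i j. 1 / real CARD('n))"

lemma averaging_matrix_idempotent:
  "averaging_matrix ** averaging_matrix = (averaging_matrix :: real^'n::finite^'n)"
  by (simp add: averaging_matrix_def matrix_matrix_mult_def vec_eq_iff)

lemma laplacian_complete_adj:
  "laplacian complete_adj
     = real CARD('n) *\<^sub>R (mat 1 - averaging_matrix :: real^'n::finite^'n)"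
proof -
  have "{v. i \<noteq> v} = UNIV - {i}" for i :: 'n by auto
  then have "real (node_degree complete_adj i) = real CARD('n) - 1" for i :: 'n
    by (simp add: node_degree_def complete_adj_def card_Diff_singleton of_nat_diff Suc_leI)
  then show ?thesis
    by (simp add: laplacian_def averaging_matrix_def complete_adj_def vec_eq_iff mat_def
        right_diff_distrib)
qed

section \<open>Heat diffusion\<close>

lemma transition_matrix_0:
  assumes "homogeneous_markov_chain P Z"
  shows "transition_matrix P Z 0 = mat 1"
proof -
  have "\<P>(\<omega> in P x. Z 0 \<omega> = y) = (if x = y then 1 else 0)" for x y
  proof -
    interpret prob_space "P x"
      using assms by (simp add: homogeneous_markov_chain_def)
    have [measurable]: "Z 0 \<in> P x \<rightarrow>\<^sub>M count_space UNIV" and start: "AE \<omega> in P x. Z 0 \<omega> = x"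
      using assms by (auto simp: homogeneous_markov_chain_def)
    have "\<P>(\<omega> in P x. Z 0 \<omega> = y) = \<P>(\<omega> in P x. x = y)"
      by (rule prob_eq_AE) (use start in auto)
    then show ?thesis using prob_space by auto
  qed
  then show ?thesis
    by (simp add: transition_matrix_def mat_def vec_eq_iff)
qed

theorem proposition3p5:
  fixes P :: "'n::finite \<Rightarrow> 'w measure" and Z :: "real \<Rightarrow> 'w \<Rightarrow> 'n" and t :: real
  assumes "t \<ge> 0"
  shows "(\<forall>i j :: 'n. mat_exp (- (t *\<^sub>R laplacian complete_adj)) $ i $ j =
            (if i = j
             then 1 / real CARD('n)
                  + (real CARD('n) - 1) / real CARD('n) * exp (- (real CARD('n) * t))
             else 1 / real CARD('n) - 1 / real CARD('n) * exp (- (real CARD('n) * t))))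
       \<and> (heat_diffusion complete_adj P Z \<longrightarrow>
            transition_matrix P Z t = mat_exp (- (t *\<^sub>R laplacian complete_adj)))"
proof -
  define Q :: "real^'n^'n" where "Q = mat 1 - averaging_matrix"
  define c where "c = - real CARD('n)"
  have Q: "Q ** Q = Q"
    unfolding Q_def by (intro idempotent_complement averaging_matrix_idempotent)
  have L: "laplacian complete_adj = - c *\<^sub>R Q"
    by (simp add: laplacian_complete_adj Q_def c_def)
  have vL: "y v* laplacian complete_adj = - (c *\<^sub>R (y v* Q))" for y
    unfolding L vector_scaleR_matrix_ac by simp
  have tL: "- (t *\<^sub>R laplacian complete_adj) = (c * t) *\<^sub>R Q"
    by (simp add: L)
  have "mat_exp ((c * t) *\<^sub>R Q) = averaging_matrix + exp (c * t) *\<^sub>R (mat 1 - averaging_matrix)"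
    by (simp add: mat_exp_scaleR_idempotent[OF Q]) (simp add: Q_def)
  then have "mat_exp ((c * t) *\<^sub>R Q) $ i $ j = 1 / real CARD('n)
      + exp (c * t) * ((if i = j then 1 else 0) - 1 / real CARD('n))" for i j
    by (simp add: averaging_matrix_def mat_def)
  then have entries: "mat_exp ((c * t) *\<^sub>R Q) $ i $ j =
            (if i = j
             then 1 / real CARD('n)
                  + (real CARD('n) - 1) / real CARD('n) * exp (- (real CARD('n) * t))
             else 1 / real CARD('n) - 1 / real CARD('n) * exp (- (real CARD('n) * t)))"
    for i j
    by (simp add: c_def field_simps)
  have "transition_matrix P Z t = mat_exp ((c * t) *\<^sub>R Q)"
    if heat: "heat_diffusion complete_adj P Z"
  proof -
    have start: "transition_matrix P Z 0 = mat 1"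
      using heat by (simp add: heat_diffusion_def transition_matrix_0)
    have "transition_matrix P Z t $ x = mat_exp ((c * t) *\<^sub>R Q) $ x" for x
    proof -
      have "((\<lambda>s. transition_matrix P Z s $ x) has_vector_derivative
          c *\<^sub>R (transition_matrix P Z s $ x v* Q)) (at s within {0..})" if "s \<ge> 0" for s
        using heat that by (simp add: heat_diffusion_def vL)
      from idempotent_linear_ode_unique[OF Q this \<open>t \<ge> 0\<close>]
      have "transition_matrix P Z t $ x = mat 1 $ x v* mat_exp ((c * t) *\<^sub>R Q)"
        by (simp add: start)
      also have "\<dots> = (mat 1 ** mat_exp ((c * t) *\<^sub>R Q)) $ x"
        by (simp add: vec_eq_iff vector_matrix_mult_def matrix_matrix_mult_def mult.commute)
      finally show ?thesis by simp
    qed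
    then show ?thesis by (simp add: vec_eq_iff)
  qed
  then show ?thesis
    using entries by (simp add: tL)
qed

end
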